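(* Let $A\in\mathbb{R}^{n\times n}$, $B\in\mathbb{R}^{n\times m}$, $H\in\mathbb{R}^{n\times q}$, $C\in\mathbb{R}^{p\times n}$, $D_y\in\mathbb{R}^{p\times m}$, $G_y\in\mathbb{R}^{p\times q}$, $E\in\mathbb{R}^{r\times n}$, $D_z\in\mathbb{R}^{r\times m}$, $G_z\in\mathbb{R}^{r\times q}$, and suppose that the disturbance decoupling problem by dynamic output feedback (Problem 1 in the context) is solvable for these data. Let $\mathcal{V}^\star=\mathcal{V}^\star_{(A,B,E,D_z)}$, $\mathcal{S}^\star=\mathcal{S}^\star_{(A,H,C,G_y)}$, and let $\mathcal{V}_m,\mathcal{S}_M$ be the subspaces defined in the context. Then the set of matrices $K\in\mathbb{R}^{m\times p}$ satisfying $$\begin{bmatrix} A+BKC & H+BKG_y \\ E+D_zKC & G_z+D_zKG_y \end{bmatrix}(\mathcal{S}^\star\oplus\mathcal{W})\subseteq \mathcal{V}^\star\oplus 0_{\mathcal{Z}}$$ coincides with the set of matrices $K\in\mathbb{R}^{m\times p}$ satisfying $$\begin{bmatrix} A+BKC & H+BKG_y \\ E+D_zKC & G_z+D_zKG_y \end{bmatrix}(\mathcal{S}_M\oplus\mathcal{W})\subseteq (\mathcal{S}_M+\mathcal{V}_m)\oplus 0_{\mathcal{Z}}.$$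
   Context: Notation: $\mathcal{X}=\mathbb{R}^n$, $\mathcal{U}=\mathbb{R}^m$, $\mathcal{W}=\mathbb{R}^q$, $\mathcal{Y}=\mathbb{R}^p$, $\mathcal{Z}=\mathbb{R}^r$; $0_{\mathcal{Z}}$ is the zero subspace of $\mathcal{Z}$; $\mathcal{S}\oplus\mathcal{W}$ is the external direct sum (product) $\{\begin{bmatrix} s \\ w \end{bmatrix}: s\in\mathcal{S}, w\in\mathcal{W}\}$. For a generic real quadruple $(\mathbf A,\mathbf B,\mathbf C,\mathbf D)$ with state space $\mathcal{X}$, input space $\mathbf U$, output space $\mathbf Y$: a subspace $\mathcal{V}\subseteq\mathcal{X}$ is $(\mathbf A,\mathbf B,\mathbf C,\mathbf D)$-output nulling if $\begin{bmatrix}\mathbf A \\ \mathbf C\end{bmatrix}\mathcal{V}\subseteq(\mathcal{V}\oplus 0_{\mathbf Y})+\operatorname{im}\begin{bmatrix}\mathbf B \\ \mathbf D\end{bmatrix}$; a subspace $\mathcal{S}\subseteq\mathcal{X}$ is $(\mathbf A,\mathbf B,\mathbf C,\mathbf D)$-input containing if $[\,\mathbf A\ \ \mathbf B\,]\big((\mathcal{S}\oplus\mathbf U)\cap\ker[\,\mathbf C\ \ \mathbf D\,]\big)\subseteq\mathcal{S}$. $\mathcal{V}^\star_{(\mathbf A,\mathbf B,\mathbf C,\mathbf D)}$ denotes the largest output nulling subspace and $\mathcal{S}^\star_{(\mathbf A,\mathbf B,\mathbf C,\mathbf D)}$ the smallest input containing subspace. Define $\mathcal{V}_m=\mathcal{V}^\star_{(A,[B\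 H],E,[D_z\ G_z])}\cap\mathcal{S}^\star_{(A,[B\ H],E,[D_z\ G_z])}$ and $\mathcal{S}_M=\mathcal{V}^\star_{(A,H,\left[\begin{smallmatrix} C \\ E \end{smallmatrix}\right],\left[\begin{smallmatrix} G_y \\ G_z \end{smallmatrix}\right])}+\mathcal{S}^\star_{(A,H,\left[\begin{smallmatrix} C \\ E \end{smallmatrix}\right],\left[\begin{smallmatrix} G_y \\ G_z \end{smallmatrix}\right])}$. Problem 1 (disturbance decoupling by dynamic output feedback) is solvable if there exist $s\in\mathbb{N}$ and matrices $A_c\in\mathbb{R}^{s\times s}$, $B_c\in\mathbb{R}^{s\times p}$, $C_c\in\mathbb{R}^{m\times s}$, $D_c\in\mathbb{R}^{m\times p}$ such that $I-D_yD_c$ is non-singular (well-posedness) and, with $W=(I-D_yD_c)^{-1}$, $\widehat A=\begin{bmatrix}A+BD_cWC & BC_c+BD_cWD_yC_c \\ B_cWC & A_c+B_cWD_yC_c\end{bmatrix}$, $\widehat H=\begin{bmatrix}H+BD_cWG_y \\ B_cWG_y\end{bmatrix}$, $\widehat C=[\,E+D_zD_cWC\ \ \ D_zC_c+D_zD_cWD_yC_c\,]$, $\widehat G=G_z+D_zD_cWG_y$, the closed-loop transfer function $G_{z,w}(\lambda)=\widehat C(\lambda I-\widehat A)^{-1}\widehat H+\widehat G$ is identically zero. (This is the closed loop of the system $\mathcal{D}x=Ax+Bu+Hw$, $y=Cx+D_yu+G_yw$, $z=Ex+D_zu+G_zw$ with the regulator $\mathcal{D}\mathsf{p}=A_c\mathsf{p}+B_cy$,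 $u=C_c\mathsf{p}+D_cy$, where $\mathsf{p}$ is the regulator state and $\mathcal{D}$ is the time derivative or unit shift.) *)

theory Defs
  imports
    "Jordan_Normal_Form.Matrix_Kernel"
    "Jordan_Normal_Form.Gauss_Jordan_Elimination"
    "HOL-Library.Set_Algebras"
    "HOL.Complex"
begin

(* R^n is carrier_vec n and R^(n x m) is carrier_mat n m, so the regulator order s in
   ddp_solvable is an ordinary bound variable. Sums of subspaces are the pointwise set sums
   of Set_Algebras. *)

abbreviation is_subspace :: "nat \<Rightarrow> real vec set \<Rightarrow> bool" where
  "is_subspace n V \<equiv> VectorSpace.subspace class_ring V (module_vec TYPE(real) n)"

definition dsum :: "real vec set \<Rightarrow> real vec set \<Rightarrow> real vec set" (infixr \<open>\<oplus>\<^sub>v\<close> 68) where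
  "S \<oplus>\<^sub>v T = {s @\<^sub>v t | s t. s \<in> S \<and> t \<in> T}"

definition append_cols :: "'a::zero mat \<Rightarrow> 'a mat \<Rightarrow> 'a mat" (infixr \<open>@\<^sub>c\<close> 66) where
  "A @\<^sub>c B = four_block_mat A B (0\<^sub>m 0 (dim_col A)) (0\<^sub>m 0 (dim_col B))"

definition mat_image :: "real mat \<Rightarrow> real vec set" where
  "mat_image M = (\<lambda>v. M *\<^sub>v v) ` carrier_vec (dim_col M)"

definition output_nulling ::
  "real mat \<Rightarrow> real mat \<Rightarrow> real mat \<Rightarrow> real mat \<Rightarrow> real vec set \<Rightarrow> bool" where
  "output_nulling A B C D V \<longleftrightarrow>
     is_subspace (dim_row A) V \<and>
     (\<lambda>v. (A @\<^sub>r C) *\<^sub>v v) ` V \<subseteq> (V \<oplus>\<^sub>v {0\<^sub>v (dim_row C)}) + mat_image (B @\<^sub>r D)"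

definition input_containing ::
  "real mat \<Rightarrow> real mat \<Rightarrow> real mat \<Rightarrow> real mat \<Rightarrow> real vec set \<Rightarrow> bool" where
  "input_containing A B C D S \<longleftrightarrow>
     is_subspace (dim_row A) S \<and>
     (\<lambda>v. (A @\<^sub>c B) *\<^sub>v v) ` ((S \<oplus>\<^sub>v carrier_vec (dim_col B)) \<inter> mat_kernel (C @\<^sub>c D)) \<subseteq> S"

(* GREATEST and LEAST are with respect to set inclusion; see Vstar_greatest and Sstar_least. *)

definition Vstar :: "real mat \<Rightarrow> real mat \<Rightarrow> real mat \<Rightarrow> real mat \<Rightarrow> real vec set" where
  "Vstar A B C D = (GREATEST V. output_nulling A B C D V)"

definition Sstar :: "real mat \<Rightarrow> real mat \<Rightarrow> real mat \<Rightarrow> real mat \<Rightarrow> real vec set" where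
  "Sstar A B C D = (LEAST S. input_containing A B C D S)"

definition V_m ::
  "real mat \<Rightarrow> real mat \<Rightarrow> real mat \<Rightarrow> real mat \<Rightarrow> real mat \<Rightarrow> real mat \<Rightarrow> real vec set" where
  "V_m A B H E Dz Gz =
     Vstar A (B @\<^sub>c H) E (Dz @\<^sub>c Gz) \<inter> Sstar A (B @\<^sub>c H) E (Dz @\<^sub>c Gz)"

definition S_M ::
  "real mat \<Rightarrow> real mat \<Rightarrow> real mat \<Rightarrow> real mat \<Rightarrow> real mat \<Rightarrow> real mat \<Rightarrow> real vec set" where
  "S_M A H C Gy E Gz =
     Vstar A H (C @\<^sub>r E) (Gy @\<^sub>r Gz) + Sstar A H (C @\<^sub>r E) (Gy @\<^sub>r Gz)"

(* Only meaningful on invertible matrices (mat_inv_correct): mat_inverse returns None otherwise. *)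
abbreviation mat_inv :: "'a::field mat \<Rightarrow> 'a mat" where
  "mat_inv M \<equiv> the (mat_inverse M)"

definition loop_W :: "real mat \<Rightarrow> real mat \<Rightarrow> real mat" where
  "loop_W Dy Dc = mat_inv (1\<^sub>m (dim_row Dy) - Dy * Dc)"

definition closed_A where
  "closed_A A B C Dy Ac Bc Cc Dc =
     (let W = loop_W Dy Dc in
      four_block_mat
        (A + B * Dc * W * C)  (B * Cc + B * Dc * W * Dy * Cc)
        (Bc * W * C)          (Ac + Bc * W * Dy * Cc))"

definition closed_H where
  "closed_H B H Dy Gy Bc Dc =
     (let W = loop_W Dy Dc in (H + B * Dc * W * Gy) @\<^sub>r (Bc * W * Gy))"

definition closed_C where
  "closed_C C Dy E Dz Cc Dc =
     (let W = loop_W Dy Dc in (E + Dz * Dc * W * C) @\<^sub>c (Dz * Cc + Dz * Dc * W * Dy * Cc))"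

definition closed_G where
  "closed_G Dy Gy Dz Gz Dc = (let W = loop_W Dy Dc in Gz + Dz * Dc * W * Gy)"

abbreviation cmat :: "real mat \<Rightarrow> complex mat" where
  "cmat \<equiv> map_mat complex_of_real"

definition transfer_function ::
  "real mat \<Rightarrow> real mat \<Rightarrow> real mat \<Rightarrow> real mat \<Rightarrow> complex \<Rightarrow> complex mat" where
  "transfer_function A B C D z =
     cmat C * mat_inv (z \<cdot>\<^sub>m 1\<^sub>m (dim_row A) - cmat A) * cmat B + cmat D"

(* The rational matrix is identically zero iff it vanishes at every complex point that is not
   an eigenvalue of A. *)
definition transfer_zero :: "real mat \<Rightarrow> real mat \<Rightarrow> real mat \<Rightarrow> real mat \<Rightarrow> bool" where
  "transfer_zero A B C D \<longleftrightarrow>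
     (\<forall>z. invertible_mat (z \<cdot>\<^sub>m 1\<^sub>m (dim_row A) - cmat A) \<longrightarrow>
        transfer_function A B C D z = 0\<^sub>m (dim_row C) (dim_col B))"

(* The order s = 0 (static regulator) is allowed. *)
definition ddp_solvable ::
  "real mat \<Rightarrow> real mat \<Rightarrow> real mat \<Rightarrow> real mat \<Rightarrow> real mat \<Rightarrow> real mat \<Rightarrow>
   real mat \<Rightarrow> real mat \<Rightarrow> real mat \<Rightarrow> bool" where
  "ddp_solvable A B H C Dy Gy E Dz Gz \<longleftrightarrow>
     (\<exists>s Ac Bc Cc Dc.
        Ac \<in> carrier_mat s s \<and> Bc \<in> carrier_mat s (dim_row C) \<and>
        Cc \<in> carrier_mat (dim_col B) s \<and> Dc \<in> carrier_mat (dim_col B) (dim_row C) \<and>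
        invertible_mat (1\<^sub>m (dim_row Dy) - Dy * Dc) \<and>
        transfer_zero
          (closed_A A B C Dy Ac Bc Cc Dc)
          (closed_H B H Dy Gy Bc Dc)
          (closed_C C Dy E Dz Cc Dc)
          (closed_G Dy Gy Dz Gz Dc))"

definition static_loop ::
  "real mat \<Rightarrow> real mat \<Rightarrow> real mat \<Rightarrow> real mat \<Rightarrow> real mat \<Rightarrow> real mat \<Rightarrow>
   real mat \<Rightarrow> real mat \<Rightarrow> real mat \<Rightarrow> real mat" where
  "static_loop A B H C Gy E Dz Gz K =
     four_block_mat
       (A + B * K * C)    (H + B * K * Gy)
       (E + Dz * K * C)   (Gz + Dz * K * Gy)"

lemma is_subspace_iff:
  "is_subspace n V \<longleftrightarrow> V \<subseteq> carrier_vec n \<and> 0\<^sub>v n \<in> V \<and>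
     (\<forall>v\<in>V. \<forall>w\<in>V. v + w \<in> V) \<and> (\<forall>c. \<forall>v\<in>V. c \<cdot>\<^sub>v v \<in> V)"
proof -
  interpret vec_space "TYPE(real)" n .
  have "vectorspace class_ring (module_vec TYPE(real) n)"
    and "Module.module class_ring (module_vec TYPE(real) n)" by unfold_locales
  then show ?thesis
    by (auto simp: VectorSpace.subspace_def submodule_def module_vec_simps)
qed

lemma mult_append_rows:
  assumes "A \<in> carrier_mat n k" "C \<in> carrier_mat p k" "v \<in> carrier_vec k"
  shows "(A @\<^sub>r C) *\<^sub>v v = (A *\<^sub>v v) @\<^sub>v (C *\<^sub>v v)"
  using assms by (rule mat_mult_append)

lemma mult_append_cols:
  assumes "A \<in> carrier_mat n k" "B \<in> carrier_mat n l" "v \<in> carrier_vec k" "w \<in> carrier_vec l"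
  shows "(A @\<^sub>c B) *\<^sub>v (v @\<^sub>v w) = A *\<^sub>v v + B *\<^sub>v w"
proof -
  have "(A @\<^sub>c B) *\<^sub>v (v @\<^sub>v w)
      = (A *\<^sub>v v + B *\<^sub>v w) @\<^sub>v (0\<^sub>m 0 k *\<^sub>v v + 0\<^sub>m 0 l *\<^sub>v w)"
    unfolding append_cols_def using assms by (auto intro!: four_block_mat_mult_vec)
  also have "\<dots> = A *\<^sub>v v + B *\<^sub>v w" using assms by (intro eq_vecI) auto
  finally show ?thesis .
qed

lemma output_nulling_iff:
  assumes "A \<in> carrier_mat n n" "B \<in> carrier_mat n m" "C \<in> carrier_mat p n" "D \<in> carrier_mat p m"
  shows "output_nulling A B C D V \<longleftrightarrow> is_subspace n V \<and>
    (\<forall>v\<in>V. \<exists>v'\<in>V. \<exists>u\<in>carrier_vec m. A *\<^sub>v v = v' + B *\<^sub>v u \<and> C *\<^sub>v v = D *\<^sub>v u)"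
proof (cases "is_subspace n V")
  case True
  then have V: "V \<subseteq> carrier_vec n" by (simp add: is_subspace_iff)
  have "(A @\<^sub>r C) *\<^sub>v v \<in> (V \<oplus>\<^sub>v {0\<^sub>v p}) + mat_image (B @\<^sub>r D) \<longleftrightarrow>
      (\<exists>v'\<in>V. \<exists>u\<in>carrier_vec m. A *\<^sub>v v = v' + B *\<^sub>v u \<and> C *\<^sub>v v = D *\<^sub>v u)"
    (is "?l = ?r") if v: "v \<in> V" for v
  proof -
    have dc: "dim_col (B @\<^sub>r D) = m" using assms by (simp add: append_rows_def)
    have "?l \<longleftrightarrow> (\<exists>v'\<in>V. \<exists>u\<in>carrier_vec m.
        (A *\<^sub>v v) @\<^sub>v (C *\<^sub>v v) = (v' @\<^sub>v 0\<^sub>v p) + ((B *\<^sub>v u) @\<^sub>v (D *\<^sub>v u)))"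
      using V v assms
      by (auto simp: set_plus_def dsum_def mat_image_def dc mult_append_rows[of _ n _ _ p] subset_iff)
    also have "\<dots> \<longleftrightarrow> ?r"
    proof (intro bex_cong refl)
      fix v' u :: "real vec" assume a: "v' \<in> V" "u \<in> carrier_vec m"
      have "(v' @\<^sub>v 0\<^sub>v p) + ((B *\<^sub>v u) @\<^sub>v (D *\<^sub>v u)) = (v' + B *\<^sub>v u) @\<^sub>v (0\<^sub>v p + D *\<^sub>v u)"
        using a V assms by (intro append_vec_add[of _ n _ _ p]) auto
      moreover have "0\<^sub>v p + D *\<^sub>v u = D *\<^sub>v u" using a assms by auto
      ultimately show "((A *\<^sub>v v) @\<^sub>v (C *\<^sub>v v) = (v' @\<^sub>v 0\<^sub>v p) + ((B *\<^sub>v u) @\<^sub>v (D *\<^sub>v u)))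
        = (A *\<^sub>v v = v' + B *\<^sub>v u \<and> C *\<^sub>v v = D *\<^sub>v u)"
        using a V v assms by (auto intro!: append_vec_eq[of _ n])
    qed
    finally show ?thesis .
  qed
  then show ?thesis using True assms by (auto simp: output_nulling_def image_subset_iff)
qed (use assms in \<open>auto simp: output_nulling_def\<close>)

lemma output_nulling_sum:
  assumes "A \<in> carrier_mat n n" "B \<in> carrier_mat n m" "C \<in> carrier_mat p n" "D \<in> carrier_mat p m"
    and V: "output_nulling A B C D V" and W: "output_nulling A B C D W"
  shows "output_nulling A B C D (V + W)"
  unfolding output_nulling_iff[OF assms(1-4)]
proof (intro conjI ballI)
  note iff = output_nulling_iff[OF assms(1-4)]
  have sV: "is_subspace n V" and sW: "is_subspace n W" using V W by (simp_all add: iff)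
  then have c: "x \<in> V \<Longrightarrow> x \<in> carrier_vec n" "x \<in> W \<Longrightarrow> x \<in> carrier_vec n" for x by (auto simp: is_subspace_iff)
  show "is_subspace n (V + W)"
    unfolding is_subspace_iff
  proof (intro conjI ballI allI)
    show "V + W \<subseteq> carrier_vec n" using c by (auto simp: set_plus_def)
    show "0\<^sub>v n \<in> V + W" using sV sW set_plus_intro[of "0\<^sub>v n" V "0\<^sub>v n" W]
      by (simp add: is_subspace_iff)
  next
    fix x y assume "x \<in> V + W" "y \<in> V + W"
    then obtain a b a' b' where *: "a \<in> V" "b \<in> W" "a' \<in> V" "b' \<in> W" "x = a + b" "y = a' + b'"
      by (auto simp: set_plus_def)
    then have "x + y = (a + a') + (b + b')" using carrier_vecD[OF c(1)] carrier_vecD[OF c(2)]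
      by (intro eq_vecI) auto
    then show "x + y \<in> V + W" using * sV sW by (simp add: is_subspace_iff set_plus_intro)
  next
    fix k x assume "x \<in> V + W"
    then obtain a b where *: "a \<in> V" "b \<in> W" "x = a + b" by (auto simp: set_plus_def)
    then have "k \<cdot>\<^sub>v x = k \<cdot>\<^sub>v a + k \<cdot>\<^sub>v b" using c by (auto intro!: smult_add_distrib_vec)
    then show "k \<cdot>\<^sub>v x \<in> V + W" using * sV sW by (simp add: is_subspace_iff set_plus_intro)
  qed
  fix x assume "x \<in> V + W"
  then obtain a b where ab: "a \<in> V" "b \<in> W" "x = a + b" by (auto simp: set_plus_def)
  obtain a' u where a: "a' \<in> V" "u \<in> carrier_vec m" "A *\<^sub>v a = a' + B *\<^sub>v u" "C *\<^sub>v a = D *\<^sub>v u"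
    using V ab unfolding iff by blast
  obtain b' w where b: "b' \<in> W" "w \<in> carrier_vec m" "A *\<^sub>v b = b' + B *\<^sub>v w" "C *\<^sub>v b = D *\<^sub>v w"
    using W ab unfolding iff by blast
  have cc: "a \<in> carrier_vec n" "b \<in> carrier_vec n" "a' \<in> carrier_vec n" "b' \<in> carrier_vec n"
    using a b ab c by auto
  have "A *\<^sub>v x = (a' + B *\<^sub>v u) + (b' + B *\<^sub>v w)"
    using ab cc a b assms by (simp add: mult_add_distrib_mat_vec)
  also have "\<dots> = (a' + b') + (B *\<^sub>v u + B *\<^sub>v w)"
    using cc a b assms by (intro eq_vecI) auto
  also have "\<dots> = (a' + b') + B *\<^sub>v (u + w)"
    using cc a b assms by (simp add: mult_add_distrib_mat_vec)
  finally have 1: "A *\<^sub>v x = (a' + b') + B *\<^sub>v (u + w)" .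
  have 2: "C *\<^sub>v x = D *\<^sub>v (u + w)"
    using ab cc a b assms by (simp add: mult_add_distrib_mat_vec)
  show "\<exists>v'\<in>V + W. \<exists>u\<in>carrier_vec m. A *\<^sub>v x = v' + B *\<^sub>v u \<and> C *\<^sub>v x = D *\<^sub>v u"
    using 1 2 a b set_plus_intro[of a' V b' W] by (intro bexI[of _ "a' + b'"] bexI[of _ "u + w"] conjI) (simp_all add: add_carrier_vec)
qed

lemma Vstar_greatest:
  assumes "A \<in> carrier_mat n n" "B \<in> carrier_mat n m" "C \<in> carrier_mat p n" "D \<in> carrier_mat p m"
  shows "output_nulling A B C D (Vstar A B C D)"
    and "output_nulling A B C D V \<Longrightarrow> V \<subseteq> Vstar A B C D"
proof -
  note iff = output_nulling_iff[OF assms]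
  define U where "U = \<Union>{V. output_nulling A B C D V}"
  have dir: "\<exists>V. output_nulling A B C D V \<and> x \<in> V \<and> y \<in> V" if xy: "x \<in> U" "y \<in> U" for x y
  proof -
    obtain V W where V: "output_nulling A B C D V" "x \<in> V"
        and W: "output_nulling A B C D W" "y \<in> W"
      using xy unfolding U_def by blast
    then have s: "is_subspace n V" "is_subspace n W" by (auto simp: iff)
    have "x = x + 0\<^sub>v n" "y = 0\<^sub>v n + y" "0\<^sub>v n \<in> V" "0\<^sub>v n \<in> W"
      using V W s by (auto simp: is_subspace_iff subset_iff)
    then have "x \<in> V + W" "y \<in> V + W" using V(2) W(2) by (metis set_plus_intro)+
    then show ?thesis using output_nulling_sum[OF assms V(1) W(1)] by blast
  qed
  have sub: "is_subspace n V" if "output_nulling A B C D V" for V using that by (simp add: iff)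
  have z: "output_nulling A B C D {0\<^sub>v n}"
    unfolding iff is_subspace_iff using assms
    by (auto intro!: bexI[of _ "0\<^sub>v m"])
  have "output_nulling A B C D U"
    unfolding iff is_subspace_iff
  proof (intro conjI ballI allI)
    show "U \<subseteq> carrier_vec n" using sub unfolding U_def is_subspace_iff by blast
    show "0\<^sub>v n \<in> U" using z by (auto simp: U_def)
    show "x + y \<in> U" if "x \<in> U" "y \<in> U" for x y
      using dir[OF that] sub unfolding U_def is_subspace_iff by blast
    show "c \<cdot>\<^sub>v x \<in> U" if "x \<in> U" for c x
      using that sub unfolding U_def is_subspace_iff by blast
    show "\<exists>v'\<in>U. \<exists>u\<in>carrier_vec m. A *\<^sub>v x = v' + B *\<^sub>v u \<and> C *\<^sub>v x = D *\<^sub>v u" if "x \<in> U" for x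
      using that unfolding U_def iff by blast
  qed
  moreover have "V \<subseteq> U" if "output_nulling A B C D V" for V
    using that by (auto simp: U_def)
  ultimately have "output_nulling A B C D (Vstar A B C D) \<and>
      (\<forall>V. output_nulling A B C D V \<longrightarrow> V \<subseteq> Vstar A B C D)"
    unfolding Vstar_def by (metis Greatest_equality)
  then show "output_nulling A B C D (Vstar A B C D)"
    and "output_nulling A B C D V \<Longrightarrow> V \<subseteq> Vstar A B C D" by auto
qed

lemma Sstar_least:
  assumes "A \<in> carrier_mat n n" "B \<in> carrier_mat n m" "C \<in> carrier_mat p n" "D \<in> carrier_mat p m"
  shows "input_containing A B C D (Sstar A B C D)"
    and "input_containing A B C D S \<Longrightarrow> Sstar A B C D \<subseteq> S"
proof -
  have dims: "dim_row A = n" "dim_col B = m" using assms by auto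
  define U where "U = \<Inter>{S. input_containing A B C D S}"
  have top: "input_containing A B C D (carrier_vec n)"
    using assms
    by (auto simp: input_containing_def is_subspace_iff dsum_def mult_append_cols[of A n n B m])
  have "is_subspace n U"
    using top unfolding U_def by (auto simp: input_containing_def dims is_subspace_iff)
  moreover have "(\<lambda>v. (A @\<^sub>c B) *\<^sub>v v) ` ((U \<oplus>\<^sub>v carrier_vec m) \<inter> mat_kernel (C @\<^sub>c D)) \<subseteq> S"
    if S: "input_containing A B C D S" for S
  proof -
    have "U \<oplus>\<^sub>v carrier_vec m \<subseteq> S \<oplus>\<^sub>v carrier_vec m" using S by (auto simp: U_def dsum_def)
    then show ?thesis using S by (auto simp: input_containing_def dims)
  qed
  then have "(\<lambda>v. (A @\<^sub>c B) *\<^sub>v v) ` ((U \<oplus>\<^sub>v carrier_vec m) \<inter> mat_kernel (C @\<^sub>c D)) \<subseteq> \<Inter>{S. input_containing A B C D S}"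
    by (intro Inter_greatest) simp
  ultimately have "input_containing A B C D U"
    unfolding input_containing_def[of A B C D U] dims by (simp add: U_def)
  moreover have "U \<subseteq> S" if "input_containing A B C D S" for S using that by (auto simp: U_def)
  ultimately have "input_containing A B C D (Sstar A B C D) \<and>
      (\<forall>S. input_containing A B C D S \<longrightarrow> Sstar A B C D \<subseteq> S)"
    unfolding Sstar_def by (metis Least_equality)
  then show "input_containing A B C D (Sstar A B C D)"
    and "input_containing A B C D S \<Longrightarrow> Sstar A B C D \<subseteq> S" by auto
qed

lemma mat_inv_correct:
  fixes M :: "'a::field mat"
  assumes M: "M \<in> carrier_mat n n" and inv: "invertible_mat M"
  shows "mat_inv M \<in> carrier_mat n n" "M * mat_inv M = 1\<^sub>m n" "mat_inv M * M = 1\<^sub>m n"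
proof -
  obtain N where N: "M * N = 1\<^sub>m n" "N * M = 1\<^sub>m (dim_row N)"
    using inv M by (auto simp: invertible_mat_def inverts_mat_def)
  have "dim_col (M * N) = n" "dim_col (N * M) = dim_row N" unfolding N by auto
  then have Nc: "N \<in> carrier_mat n n" using M by auto
  then have "M \<in> Units (ring_mat TYPE('a) n ())"
    using M N by (auto simp: Units_def ring_mat_def)
  then obtain N' where "mat_inverse M = Some N'" 
    using mat_inverse(1)[OF M, where b = "()"] by (cases "mat_inverse M") auto
  then show "mat_inv M \<in> carrier_mat n n" "M * mat_inv M = 1\<^sub>m n" "mat_inv M * M = 1\<^sub>m n"
    using mat_inverse(2)[OF M] by auto
qed

end

theory Submission
  imports Defs
begin

text \<open>The equality of the two sets holds gain by gain: for each \<open>K\<close> the two inclusions are equivalent.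
Write \<open>L\<close> for the static closed loop with \<open>u = K y\<close>, \<open>y = C x + Gy w\<close>, and index the subspaces by
what is adjoined to the plant: \<open>V_bh\<close>, \<open>S_bh\<close> when the disturbance counts as a further input
(matrices \<open>[B H]\<close>, \<open>[Dz Gz]\<close>), \<open>V_ce\<close>, \<open>S_ce\<close> when the controlled output counts as a further
measurement (matrices \<open>[C; E]\<close>, \<open>[Gy; Gz]\<close>). Thus \<open>V_m = V_bh \<inter> S_bh\<close> and \<open>S_M = V_ce + S_ce\<close>;
\<open>V*\<close> and \<open>S*\<close> are the subspaces without anything adjoined.

Where \<open>y = 0\<close> the gain is invisible to the loop. If \<open>L\<close> makes \<open>z\<close> vanish on \<open>S_ce \<oplus> W\<close>, then every
\<open>(s, w)\<close> there with \<open>y = 0\<close> also has \<open>E s + Gz w = 0\<close>. Measuring \<open>z\<close> in addition then imposes no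
further constraint, so \<open>S_ce\<close> is input containing for \<open>y\<close> alone, and \<open>S* \<subseteq> S_ce\<close>. Either of the
two inclusions provides this, because \<open>S_ce \<subseteq> S*\<close> always and \<open>S_ce \<subseteq> S_M\<close> by construction.

Suppose \<open>L (S* \<oplus> W) \<subseteq> V* \<oplus> 0\<close>. Since \<open>S* \<subseteq> S_ce \<subseteq> S_bh\<close>, a step of \<open>L\<close> from \<open>S*\<close> is a step of
the plant with inputs \<open>(u, w)\<close> and \<open>z = 0\<close> that starts in \<open>S_bh\<close>; it stays in \<open>S_bh\<close>. It also lands
in \<open>V* \<subseteq> V_bh\<close>, so in \<open>V_m\<close>. On \<open>V_ce\<close> a disturbance can be chosen that cancels both outputs:
\<open>L (v, - w0) = (v', 0)\<close> with \<open>v' \<in> V_ce\<close>. Adding the two cases gives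
\<open>L (S_M \<oplus> W) \<subseteq> (S_M + V_m) \<oplus> 0\<close>.

Suppose \<open>L (S_M \<oplus> W) \<subseteq> (S_M + V_m) \<oplus> 0\<close>. Then \<open>S_M + V_bh\<close> is output nulling by means of \<open>u\<close> alone:
the disturbance that a vector of \<open>V_bh\<close> requires can be traded for the input that \<open>L\<close> generates in
response to it. Hence \<open>S_M + V_m \<subseteq> S_M + V_bh \<subseteq> V*\<close>, and restricting \<open>L\<close> from \<open>S_M\<close> to
\<open>S* \<subseteq> S_M\<close> gives \<open>L (S* \<oplus> W) \<subseteq> V* \<oplus> 0\<close>.\<close>

section \<open>Subspaces, elementwise\<close>

lemma append_mem_dsum_zero_iff:
  assumes "T \<subseteq> carrier_vec n" "a \<in> carrier_vec n"
  shows "a @\<^sub>v b \<in> T \<oplus>\<^sub>v {0\<^sub>v r} \<longleftrightarrow> a \<in> T \<and> b = 0\<^sub>v r"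
proof -
  have "a @\<^sub>v b = t @\<^sub>v 0\<^sub>v r \<longleftrightarrow> a = t \<and> b = 0\<^sub>v r" if "t \<in> T" for t
    using that assms by (intro append_vec_eq) auto
  then show ?thesis by (auto simp: dsum_def)
qed

lemma is_subspace_sum:
  assumes "is_subspace n V" "is_subspace n W"
  shows "is_subspace n (V + W)"
proof -
  \<comment> \<open>Every subspace is output nulling for the zero system, so closure under sums is inherited.\<close>
  have zero: "0\<^sub>m n n \<in> carrier_mat n n" "0\<^sub>m n 0 \<in> carrier_mat n 0"
    "0\<^sub>m 0 n \<in> carrier_mat 0 n" "0\<^sub>m 0 0 \<in> carrier_mat 0 (0::nat)" by auto
  have "output_nulling (0\<^sub>m n n) (0\<^sub>m n 0) (0\<^sub>m 0 n) (0\<^sub>m 0 0) U" if "is_subspace n U" for U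
    unfolding output_nulling_iff[OF zero]
  proof (intro conjI ballI that)
    fix v assume "v \<in> U"
    then have "v \<in> carrier_vec n" "0\<^sub>v n \<in> U" using that by (auto simp: is_subspace_iff)
    then show "\<exists>v'\<in>U. \<exists>u\<in>carrier_vec 0.
        0\<^sub>m n n *\<^sub>v v = v' + 0\<^sub>m n 0 *\<^sub>v u \<and> 0\<^sub>m 0 n *\<^sub>v v = 0\<^sub>m 0 0 *\<^sub>v u"
      by (intro bexI[of _ "0\<^sub>v n"] bexI[of _ "0\<^sub>v 0"] conjI eq_vecI) auto
  qed
  from output_nulling_sum[OF zero this[OF assms(1)] this[OF assms(2)]]
  show ?thesis by (simp add: output_nulling_def)
qed

lemma subset_sum_left:
  assumes "is_subspace n V" "is_subspace n W"
  shows "V \<subseteq> V + W"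
proof
  fix x assume "x \<in> V"
  moreover from this have "x = x + 0\<^sub>v n" using assms by (auto simp: is_subspace_iff subset_iff)
  ultimately show "x \<in> V + W"
    using assms(2) by (metis is_subspace_iff set_plus_intro)
qed

lemma subset_sum_right:
  assumes "is_subspace n V" "is_subspace n W"
  shows "W \<subseteq> V + W"
proof
  fix x assume "x \<in> W"
  moreover from this have "x = 0\<^sub>v n + x" using assms by (auto simp: is_subspace_iff subset_iff)
  ultimately show "x \<in> V + W"
    using assms(1) by (metis is_subspace_iff set_plus_intro)
qed

lemma append_cols_carrier [intro]:
  "A \<in> carrier_mat n k \<Longrightarrow> B \<in> carrier_mat n l \<Longrightarrow> A @\<^sub>c B \<in> carrier_mat n (k + l)"
  by (auto simp: append_cols_def)

lemma mult_mat_vec_zero: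
  "M \<in> carrier_mat k l \<Longrightarrow> M *\<^sub>v 0\<^sub>v l = (0\<^sub>v k :: 'a :: semiring_0 vec)"
  by (intro eq_vecI) auto

lemma bex_vec_append:
  "(\<exists>x\<in>carrier_vec (m + q). P x) \<longleftrightarrow>
     (\<exists>u\<in>carrier_vec m. \<exists>w\<in>carrier_vec q. P (u @\<^sub>v w))"
  using all_vec_append[of m q "\<lambda>u. \<not> P u"] by blast

lemma input_containing_iff:
  assumes "A \<in> carrier_mat n n" "B \<in> carrier_mat n m" "C \<in> carrier_mat p n" "D \<in> carrier_mat p m"
  shows "input_containing A B C D S \<longleftrightarrow> is_subspace n S \<and>
    (\<forall>s\<in>S. \<forall>u\<in>carrier_vec m. C *\<^sub>v s + D *\<^sub>v u = 0\<^sub>v p \<longrightarrow> A *\<^sub>v s + B *\<^sub>v u \<in> S)"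
proof (cases "is_subspace n S")
  case True
  then have S: "S \<subseteq> carrier_vec n" by (simp add: is_subspace_iff)
  have "C @\<^sub>c D \<in> carrier_mat p (n + m)" using assms by auto
  then have ker: "s @\<^sub>v u \<in> mat_kernel (C @\<^sub>c D) \<longleftrightarrow> C *\<^sub>v s + D *\<^sub>v u = 0\<^sub>v p"
    if "s \<in> S" "u \<in> carrier_vec m" for s u
    using S that assms by (auto simp: mat_kernel mult_append_cols[of C p n D m])
  have "(\<forall>x\<in>(S \<oplus>\<^sub>v carrier_vec m) \<inter> mat_kernel (C @\<^sub>c D). (A @\<^sub>c B) *\<^sub>v x \<in> S) \<longleftrightarrow>
      (\<forall>s\<in>S. \<forall>u\<in>carrier_vec m.
        s @\<^sub>v u \<in> mat_kernel (C @\<^sub>c D) \<longrightarrow> (A @\<^sub>c B) *\<^sub>v (s @\<^sub>v u) \<in> S)"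
    by (auto simp: dsum_def)
  also have "\<dots> \<longleftrightarrow> (\<forall>s\<in>S. \<forall>u\<in>carrier_vec m. C *\<^sub>v s + D *\<^sub>v u = 0\<^sub>v p \<longrightarrow> A *\<^sub>v s + B *\<^sub>v u \<in> S)"
    using S assms by (intro ball_cong refl) (auto simp: ker mult_append_cols[of A n n B m] subset_iff)
  finally show ?thesis using True assms by (simp add: input_containing_def image_subset_iff)
qed (use assms in \<open>auto simp: input_containing_def\<close>)

section \<open>The two subspace pairs of a plant\<close>

locale plant =
  fixes n m q p r :: nat
    and A B H C Gy E Dz Gz :: "real mat"
  assumes A [simp]: "A \<in> carrier_mat n n" and B [simp]: "B \<in> carrier_mat n m"
    and H [simp]: "H \<in> carrier_mat n q"
    and C [simp]: "C \<in> carrier_mat p n" and Gy [simp]: "Gy \<in> carrier_mat p q"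
    and E [simp]: "E \<in> carrier_mat r n" and Dz [simp]: "Dz \<in> carrier_mat r m"
    and Gz [simp]: "Gz \<in> carrier_mat r q"
begin

abbreviation "V_bh \<equiv> Vstar A (B @\<^sub>c H) E (Dz @\<^sub>c Gz)"
abbreviation "S_bh \<equiv> Sstar A (B @\<^sub>c H) E (Dz @\<^sub>c Gz)"
abbreviation "V_ce \<equiv> Vstar A H (C @\<^sub>r E) (Gy @\<^sub>r Gz)"
abbreviation "S_ce \<equiv> Sstar A H (C @\<^sub>r E) (Gy @\<^sub>r Gz)"
abbreviation "SM \<equiv> S_M A H C Gy E Gz"
abbreviation "Vm \<equiv> V_m A B H E Dz Gz"

lemma appended [simp]:
  "B @\<^sub>c H \<in> carrier_mat n (m + q)" "Dz @\<^sub>c Gz \<in> carrier_mat r (m + q)"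
  "C @\<^sub>r E \<in> carrier_mat (p + r) n" "Gy @\<^sub>r Gz \<in> carrier_mat (p + r) q"
  by auto

lemma dims [simp]:
  "dim_row A = n" "dim_row B = n" "dim_row H = n" "dim_row C = p" "dim_row Gy = p"
  "dim_row E = r" "dim_row Dz = r" "dim_row Gz = r"
  using A B H C Gy E Dz Gz unfolding carrier_mat_def by blast+

lemma mult_vec_carrier [simp]:
  "x \<in> carrier_vec n \<Longrightarrow> A *\<^sub>v x \<in> carrier_vec n" "x \<in> carrier_vec n \<Longrightarrow> C *\<^sub>v x \<in> carrier_vec p"
  "x \<in> carrier_vec n \<Longrightarrow> E *\<^sub>v x \<in> carrier_vec r"
  "u \<in> carrier_vec m \<Longrightarrow> B *\<^sub>v u \<in> carrier_vec n" "u \<in> carrier_vec m \<Longrightarrow> Dz *\<^sub>v u \<in> carrier_vec r"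
  "w \<in> carrier_vec q \<Longrightarrow> H *\<^sub>v w \<in> carrier_vec n" "w \<in> carrier_vec q \<Longrightarrow> Gy *\<^sub>v w \<in> carrier_vec p"
  "w \<in> carrier_vec q \<Longrightarrow> Gz *\<^sub>v w \<in> carrier_vec r"
  by (auto intro: mult_mat_vec_carrier[OF A] mult_mat_vec_carrier[OF B] mult_mat_vec_carrier[OF H]
      mult_mat_vec_carrier[OF C] mult_mat_vec_carrier[OF Gy] mult_mat_vec_carrier[OF E]
      mult_mat_vec_carrier[OF Dz] mult_mat_vec_carrier[OF Gz])

lemmas distrib = mult_add_distrib_mat_vec[OF A] mult_add_distrib_mat_vec[OF B]
  mult_add_distrib_mat_vec[OF H] mult_add_distrib_mat_vec[OF C] mult_add_distrib_mat_vec[OF Gy]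
  mult_add_distrib_mat_vec[OF E] mult_add_distrib_mat_vec[OF Dz] mult_add_distrib_mat_vec[OF Gz]

lemma output_nulling_bh_iff:
  "output_nulling A (B @\<^sub>c H) E (Dz @\<^sub>c Gz) V \<longleftrightarrow> is_subspace n V \<and>
    (\<forall>v\<in>V. \<exists>v'\<in>V. \<exists>u\<in>carrier_vec m. \<exists>w\<in>carrier_vec q.
      A *\<^sub>v v = v' + (B *\<^sub>v u + H *\<^sub>v w) \<and> E *\<^sub>v v = Dz *\<^sub>v u + Gz *\<^sub>v w)"
  by (simp add: output_nulling_iff[of A n _ "m + q" _ r] bex_vec_append
      mult_append_cols[of _ n m _ q] mult_append_cols[of _ r m _ q] cong: bex_cong)

lemma input_containing_bh_iff:
  "input_containing A (B @\<^sub>c H) E (Dz @\<^sub>c Gz) S \<longleftrightarrow> is_subspace n S \<and>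
    (\<forall>s\<in>S. \<forall>u\<in>carrier_vec m. \<forall>w\<in>carrier_vec q.
      E *\<^sub>v s + (Dz *\<^sub>v u + Gz *\<^sub>v w) = 0\<^sub>v r \<longrightarrow> A *\<^sub>v s + (B *\<^sub>v u + H *\<^sub>v w) \<in> S)"
  by (simp add: input_containing_iff[of A n _ "m + q" _ r] all_vec_append
      mult_append_cols[of _ n m _ q] mult_append_cols[of _ r m _ q] cong: ball_cong)

lemma output_nulling_ce_iff:
  "output_nulling A H (C @\<^sub>r E) (Gy @\<^sub>r Gz) V \<longleftrightarrow> is_subspace n V \<and>
    (\<forall>v\<in>V. \<exists>v'\<in>V. \<exists>w\<in>carrier_vec q.
      A *\<^sub>v v = v' + H *\<^sub>v w \<and> C *\<^sub>v v = Gy *\<^sub>v w \<and> E *\<^sub>v v = Gz *\<^sub>v w)"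
proof -
  have eq: "(C @\<^sub>r E) *\<^sub>v v = (Gy @\<^sub>r Gz) *\<^sub>v w \<longleftrightarrow> C *\<^sub>v v = Gy *\<^sub>v w \<and> E *\<^sub>v v = Gz *\<^sub>v w"
    if "v \<in> carrier_vec n" "w \<in> carrier_vec q" for v w
    unfolding mult_append_rows[OF C E that(1)] mult_append_rows[OF Gy Gz that(2)]
    by (rule append_vec_eq[of _ p]) (use that in auto)
  show ?thesis
    unfolding output_nulling_iff[OF A H appended(3,4)]
    by (intro conj_cong ball_cong bex_cong refl) (auto simp: eq is_subspace_iff)
qed

lemma input_containing_ce_iff:
  "input_containing A H (C @\<^sub>r E) (Gy @\<^sub>r Gz) S \<longleftrightarrow> is_subspace n S \<and>
    (\<forall>s\<in>S. \<forall>w\<in>carrier_vec q.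
      C *\<^sub>v s + Gy *\<^sub>v w = 0\<^sub>v p \<and> E *\<^sub>v s + Gz *\<^sub>v w = 0\<^sub>v r \<longrightarrow> A *\<^sub>v s + H *\<^sub>v w \<in> S)"
proof -
  have eq: "(C @\<^sub>r E) *\<^sub>v s + (Gy @\<^sub>r Gz) *\<^sub>v w = 0\<^sub>v (p + r) \<longleftrightarrow>
      C *\<^sub>v s + Gy *\<^sub>v w = 0\<^sub>v p \<and> E *\<^sub>v s + Gz *\<^sub>v w = 0\<^sub>v r"
    if "s \<in> carrier_vec n" "w \<in> carrier_vec q" for s w
  proof -
    have "(C @\<^sub>r E) *\<^sub>v s + (Gy @\<^sub>r Gz) *\<^sub>v w = (C *\<^sub>v s + Gy *\<^sub>v w) @\<^sub>v (E *\<^sub>v s + Gz *\<^sub>v w)"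
      unfolding mult_append_rows[OF C E that(1)] mult_append_rows[OF Gy Gz that(2)]
      by (rule append_vec_add[of _ p _ _ r]) (use that in auto)
    moreover have "0\<^sub>v (p + r) = 0\<^sub>v p @\<^sub>v 0\<^sub>v r" by (intro eq_vecI) auto
    ultimately show ?thesis
      using append_vec_eq[of "C *\<^sub>v s + Gy *\<^sub>v w" p "0\<^sub>v p"] that
      by (metis add_carrier_vec mult_vec_carrier(2,7) zero_carrier_vec)
  qed
  show ?thesis
    unfolding input_containing_iff[OF A H appended(3,4)]
    by (intro conj_cong ball_cong refl) (auto simp: eq is_subspace_iff)
qed

text \<open>The loop matrix encodes the interconnection \<open>u = K y\<close>. Keeping \<open>K *\<^sub>v y\<close> as a single vector
makes each step of the loop visibly a step of the plant with inputs \<open>u\<close> and \<open>w\<close>, to which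
the invariance properties of \<open>V_bh\<close> and \<open>S_bh\<close> apply.\<close>

lemma static_loop_image_subset_iff:
  assumes K: "K \<in> carrier_mat m p" and S: "S \<subseteq> carrier_vec n" and T: "T \<subseteq> carrier_vec n"
  shows "(\<lambda>v. static_loop A B H C Gy E Dz Gz K *\<^sub>v v) ` (S \<oplus>\<^sub>v carrier_vec q) \<subseteq> T \<oplus>\<^sub>v {0\<^sub>v r} \<longleftrightarrow>
    (\<forall>x\<in>S. \<forall>w\<in>carrier_vec q.
      A *\<^sub>v x + (B *\<^sub>v (K *\<^sub>v (C *\<^sub>v x + Gy *\<^sub>v w)) + H *\<^sub>v w) \<in> T \<and>
      E *\<^sub>v x + (Dz *\<^sub>v (K *\<^sub>v (C *\<^sub>v x + Gy *\<^sub>v w)) + Gz *\<^sub>v w) = 0\<^sub>v r)"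
proof -
  \<comment> \<open>Both block rows of the loop matrix have the same shape; \<open>L\<close> stands for \<open>B\<close> or \<open>Dz\<close>.\<close>
  have row: "(M + L * K * C) *\<^sub>v x + (N + L * K * Gy) *\<^sub>v w
      = M *\<^sub>v x + (L *\<^sub>v (K *\<^sub>v (C *\<^sub>v x + Gy *\<^sub>v w)) + N *\<^sub>v w)"
    if d: "M \<in> carrier_mat k n" "L \<in> carrier_mat k m" "N \<in> carrier_mat k q"
      "x \<in> carrier_vec n" "w \<in> carrier_vec q" for M L N :: "real mat" and k x w
  proof -
    have LK: "L * K \<in> carrier_mat k p" using d K by auto
    have "L *\<^sub>v (K *\<^sub>v (C *\<^sub>v x + Gy *\<^sub>v w)) = (L * K) *\<^sub>v (C *\<^sub>v x + Gy *\<^sub>v w)"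
      using d K by (subst assoc_mult_mat_vec[of L k m K p]) (auto intro!: add_carrier_vec)
    also have "\<dots> = (L * K * C) *\<^sub>v x + (L * K * Gy) *\<^sub>v w"
      using d LK by (simp add: mult_add_distrib_mat_vec[OF LK] assoc_mult_mat_vec[OF LK C]
          assoc_mult_mat_vec[OF LK Gy])
    finally have 1: "L *\<^sub>v (K *\<^sub>v (C *\<^sub>v x + Gy *\<^sub>v w)) = (L * K * C) *\<^sub>v x + (L * K * Gy) *\<^sub>v w" .
    have LKC: "L * K * C \<in> carrier_mat k n" "L * K * Gy \<in> carrier_mat k q"
      using mult_carrier_mat[OF LK C] mult_carrier_mat[OF LK Gy] by auto
    have "dim_row M = k" "dim_row L = k" "dim_row N = k" using d by auto
    then show ?thesis unfolding 1
      using d LKC by (simp add: add_mult_distrib_mat_vec[of _ k n] add_mult_distrib_mat_vec[of _ k q])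
        (intro eq_vecI; simp)
  qed
  have act: "static_loop A B H C Gy E Dz Gz K *\<^sub>v (x @\<^sub>v w)
      = (A *\<^sub>v x + (B *\<^sub>v (K *\<^sub>v (C *\<^sub>v x + Gy *\<^sub>v w)) + H *\<^sub>v w))
        @\<^sub>v (E *\<^sub>v x + (Dz *\<^sub>v (K *\<^sub>v (C *\<^sub>v x + Gy *\<^sub>v w)) + Gz *\<^sub>v w))"
    if "x \<in> carrier_vec n" "w \<in> carrier_vec q" for x w
  proof -
    have "static_loop A B H C Gy E Dz Gz K *\<^sub>v (x @\<^sub>v w)
      = ((A + B * K * C) *\<^sub>v x + (H + B * K * Gy) *\<^sub>v w)
        @\<^sub>v ((E + Dz * K * C) *\<^sub>v x + (Gz + Dz * K * Gy) *\<^sub>v w)"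
      unfolding static_loop_def
      by (rule four_block_mat_mult_vec[of _ n n _ q _ r])
        (use K that mult_carrier_mat[OF mult_carrier_mat[OF B K] C]
          mult_carrier_mat[OF mult_carrier_mat[OF B K] Gy]
          mult_carrier_mat[OF mult_carrier_mat[OF Dz K] C]
          mult_carrier_mat[OF mult_carrier_mat[OF Dz K] Gy] in auto)
    then show ?thesis unfolding row[OF A B H that] row[OF E Dz Gz that] .
  qed
  have Kc: "K *\<^sub>v y \<in> carrier_vec m" if "y \<in> carrier_vec p" for y
    using mult_mat_vec_carrier[OF K that] .
  have mem: "static_loop A B H C Gy E Dz Gz K *\<^sub>v (x @\<^sub>v w) \<in> T \<oplus>\<^sub>v {0\<^sub>v r} \<longleftrightarrow>
      A *\<^sub>v x + (B *\<^sub>v (K *\<^sub>v (C *\<^sub>v x + Gy *\<^sub>v w)) + H *\<^sub>v w) \<in> T \<and>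
      E *\<^sub>v x + (Dz *\<^sub>v (K *\<^sub>v (C *\<^sub>v x + Gy *\<^sub>v w)) + Gz *\<^sub>v w) = 0\<^sub>v r"
    if "x \<in> S" "w \<in> carrier_vec q" for x w
    unfolding act[OF subsetD[OF S that(1)] that(2)]
    by (rule append_mem_dsum_zero_iff[OF T]) (use S that Kc in \<open>auto intro!: add_carrier_vec\<close>)
  have "f ` (S \<oplus>\<^sub>v carrier_vec q) \<subseteq> U \<longleftrightarrow> (\<forall>x\<in>S. \<forall>w\<in>carrier_vec q. f (x @\<^sub>v w) \<in> U)"
    for f and U :: "real vec set" by (auto simp: dsum_def)
  then show ?thesis by (simp only: mem cong: ball_cong)
qed

lemma is_subspaces:
  "is_subspace n (Vstar A B E Dz)" "is_subspace n (Sstar A H C Gy)"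
  "is_subspace n V_bh" "is_subspace n S_bh" "is_subspace n V_ce" "is_subspace n S_ce"
  using Vstar_greatest(1)[OF A B E Dz] Sstar_least(1)[OF A H C Gy]
    Vstar_greatest(1)[OF A appended(1) E appended(2)] Sstar_least(1)[OF A appended(1) E appended(2)]
    Vstar_greatest(1)[OF A H appended(3,4)] Sstar_least(1)[OF A H appended(3,4)] A
  by (auto simp: output_nulling_def input_containing_def)

lemma is_subspace_SM: "is_subspace n SM"
  unfolding S_M_def by (intro is_subspace_sum is_subspaces)

lemma is_subspace_Vm: "is_subspace n Vm"
  using is_subspaces(3,4) by (auto simp: V_m_def is_subspace_iff)

lemma S_ce_subset_SM: "S_ce \<subseteq> SM"
  unfolding S_M_def using subset_sum_right is_subspaces(5,6) .

section \<open>Comparisons that hold for every plant\<close>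

text \<open>A further measurement leaves fewer pairs \<open>(s, w)\<close> unobserved, so it weakens the condition on an input
containing subspace.\<close>

lemma S_ce_subset_Sstar: "S_ce \<subseteq> Sstar A H C Gy"
proof (rule Sstar_least(2)[OF A H appended(3,4)])
  show "input_containing A H (C @\<^sub>r E) (Gy @\<^sub>r Gz) (Sstar A H C Gy)"
    using Sstar_least(1)[OF A H C Gy]
    by (auto simp: input_containing_ce_iff input_containing_iff[OF A H C Gy])
qed

text \<open>The hypothesis says that on \<open>S_ce\<close> the pairs unobserved by \<open>y\<close> are already unobserved by \<open>z\<close>.
It is needed only on \<open>S_ce\<close>, the smaller of the two subspaces, which lets one lemma serve both
inclusions of the theorem.\<close>

lemma Sstar_subset_S_ce:
  assumes "\<And>s w. s \<in> S_ce \<Longrightarrow> w \<in> carrier_vec q \<Longrightarrow>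
    C *\<^sub>v s + Gy *\<^sub>v w = 0\<^sub>v p \<Longrightarrow> E *\<^sub>v s + Gz *\<^sub>v w = 0\<^sub>v r"
  shows "Sstar A H C Gy \<subseteq> S_ce"
proof (rule Sstar_least(2)[OF A H C Gy])
  show "input_containing A H C Gy S_ce"
    using Sstar_least(1)[OF A H appended(3,4)] assms
    by (auto simp: input_containing_ce_iff input_containing_iff[OF A H C Gy])
qed

text \<open>Taking \<open>u = 0\<close>, and dropping the condition on \<open>y\<close>, shows that \<open>S_bh\<close> absorbs every step that
\<open>S_ce\<close> has to absorb.\<close>

lemma S_ce_subset_S_bh: "S_ce \<subseteq> S_bh"
proof (rule Sstar_least(2)[OF A H appended(3,4)])
  have bh: "A *\<^sub>v s + (B *\<^sub>v u + H *\<^sub>v w) \<in> S_bh"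
    if "s \<in> S_bh" "u \<in> carrier_vec m" "w \<in> carrier_vec q"
      "E *\<^sub>v s + (Dz *\<^sub>v u + Gz *\<^sub>v w) = 0\<^sub>v r" for s u w
    using Sstar_least(1)[OF A appended(1) E appended(2)] that
    unfolding input_containing_bh_iff by blast
  have "A *\<^sub>v s + H *\<^sub>v w \<in> S_bh"
    if "s \<in> S_bh" "w \<in> carrier_vec q" "E *\<^sub>v s + Gz *\<^sub>v w = 0\<^sub>v r" for s w
    using bh[of s "0\<^sub>v m" w] that by (simp add: mult_mat_vec_zero[OF B] mult_mat_vec_zero[OF Dz])
  then show "input_containing A H (C @\<^sub>r E) (Gy @\<^sub>r Gz) S_bh"
    using is_subspaces(4) by (auto simp: input_containing_ce_iff)
qed

text \<open>The additional input of \<open>V_bh\<close> may be left at \<open>w = 0\<close>.\<close>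

lemma Vstar_subset_V_bh: "Vstar A B E Dz \<subseteq> V_bh"
proof (rule Vstar_greatest(2)[OF A appended(1) E appended(2)])
  have "\<exists>v'\<in>Vstar A B E Dz. \<exists>u\<in>carrier_vec m. \<exists>w\<in>carrier_vec q.
      A *\<^sub>v v = v' + (B *\<^sub>v u + H *\<^sub>v w) \<and> E *\<^sub>v v = Dz *\<^sub>v u + Gz *\<^sub>v w"
    if v: "v \<in> Vstar A B E Dz" for v
  proof -
    obtain v' u where "v' \<in> Vstar A B E Dz" "u \<in> carrier_vec m"
      "A *\<^sub>v v = v' + B *\<^sub>v u" "E *\<^sub>v v = Dz *\<^sub>v u"
      using Vstar_greatest(1)[OF A B E Dz] v unfolding output_nulling_iff[OF A B E Dz] by blast
    then show ?thesis
      by (intro bexI[of _ v'] bexI[of _ u] bexI[of _ "0\<^sub>v q"]) (simp_all add: mult_mat_vec_zero[OF H] mult_mat_vec_zero[OF Gz])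
  qed
  then show "output_nulling A (B @\<^sub>c H) E (Dz @\<^sub>c Gz) (Vstar A B E Dz)"
    using is_subspaces(1) by (simp add: output_nulling_bh_iff)
qed

section \<open>Equivalence of the two inclusions for a gain\<close>

context
  fixes K :: "real mat"
  assumes K: "K \<in> carrier_mat m p"
begin

abbreviation feedback :: "real vec \<Rightarrow> real vec \<Rightarrow> real vec" where
  "feedback x w \<equiv> K *\<^sub>v (C *\<^sub>v x + Gy *\<^sub>v w)"

text \<open>The inclusion of \<open>static_loop_image_subset_iff\<close>: the loop closed by \<open>K\<close> sends \<open>S \<oplus> W\<close> into \<open>T \<oplus> 0\<close>.\<close>

definition loop_maps_into :: "real vec set \<Rightarrow> real vec set \<Rightarrow> bool" where
  "loop_maps_into S T \<longleftrightarrow> (\<forall>x\<in>S. \<forall>w\<in>carrier_vec q.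
      A *\<^sub>v x + (B *\<^sub>v feedback x w + H *\<^sub>v w) \<in> T \<and>
      E *\<^sub>v x + (Dz *\<^sub>v feedback x w + Gz *\<^sub>v w) = 0\<^sub>v r)"

lemma feedback_carrier:
  "x \<in> carrier_vec n \<Longrightarrow> w \<in> carrier_vec q \<Longrightarrow> feedback x w \<in> carrier_vec m"
  using K by (auto intro!: mult_mat_vec_carrier[OF K] add_carrier_vec)

text \<open>Where \<open>y = 0\<close> the feedback is zero, so the loop having \<open>z = 0\<close> is a property of the open-loop plant.\<close>

lemma Sstar_subset_S_ce_if_loop_maps_into:
  assumes "loop_maps_into S T" "S_ce \<subseteq> S"
  shows "Sstar A H C Gy \<subseteq> S_ce"
proof (rule Sstar_subset_S_ce)
  fix s w assume s: "s \<in> S_ce" "w \<in> carrier_vec q" "C *\<^sub>v s + Gy *\<^sub>v w = 0\<^sub>v p"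
  then have "E *\<^sub>v s + (Dz *\<^sub>v feedback s w + Gz *\<^sub>v w) = 0\<^sub>v r"
    using assms unfolding loop_maps_into_def by blast
  moreover have "feedback s w = 0\<^sub>v m" using s by (simp add: mult_mat_vec_zero[OF K])
  ultimately show "E *\<^sub>v s + Gz *\<^sub>v w = 0\<^sub>v r" using s by (simp add: mult_mat_vec_zero[OF Dz])
qed

text \<open>The summands of \<open>S_M\<close> behave differently: steps from \<open>S*\<close> land in \<open>V_m\<close>, while a vector of \<open>V_ce\<close> stays
in \<open>V_ce\<close> up to a disturbance, which is handed over to the step from \<open>S*\<close>.\<close>

lemma loop_maps_into_SM_if_loop_maps_into_Vstar:
  assumes maps: "loop_maps_into (Sstar A H C Gy) (Vstar A B E Dz)"
  shows "loop_maps_into SM (SM + Vm)"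
proof -
  have sub: "Sstar A H C Gy \<subseteq> S_bh"
    using Sstar_subset_S_ce_if_loop_maps_into[OF maps S_ce_subset_Sstar] S_ce_subset_S_bh by blast
  have step: "A *\<^sub>v s + (B *\<^sub>v feedback s w + H *\<^sub>v w) \<in> Vm"
    if s: "s \<in> Sstar A H C Gy" and w: "w \<in> carrier_vec q" for s w
  proof -
    have "s \<in> carrier_vec n" using s is_subspaces(2) by (auto simp: is_subspace_iff)
    then have "A *\<^sub>v s + (B *\<^sub>v feedback s w + H *\<^sub>v w) \<in> S_bh"
      using Sstar_least(1)[OF A appended(1) E appended(2)] maps s w sub feedback_carrier
      unfolding input_containing_bh_iff loop_maps_into_def by blast
    then show ?thesis
      using maps s w Vstar_subset_V_bh by (auto simp: loop_maps_into_def V_m_def)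
  qed
  show ?thesis unfolding loop_maps_into_def
  proof (intro ballI)
    fix x w :: "real vec" assume x: "x \<in> SM" and w: "w \<in> carrier_vec q"
    obtain v s where vs: "v \<in> V_ce" "s \<in> S_ce" "x = v + s"
      using x unfolding S_M_def by (auto simp: set_plus_def)
    obtain v' w0 where v': "v' \<in> V_ce" "w0 \<in> carrier_vec q" "A *\<^sub>v v = v' + H *\<^sub>v w0"
        "C *\<^sub>v v = Gy *\<^sub>v w0" "E *\<^sub>v v = Gz *\<^sub>v w0"
      using Vstar_greatest(1)[OF A H appended(3,4)] vs(1)
      unfolding output_nulling_ce_iff by blast
    have c: "v \<in> carrier_vec n" "s \<in> carrier_vec n" "v' \<in> carrier_vec n"
      using vs v' is_subspaces(5,6) by (auto simp: is_subspace_iff)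
    have s: "s \<in> Sstar A H C Gy" using vs S_ce_subset_Sstar by blast
    have ww: "w0 + w \<in> carrier_vec q" using v' w by simp
    \<comment> \<open>The measurement of \<open>v\<close> is that of the disturbance \<open>w0\<close>, so \<open>K\<close> cannot tell \<open>(v + s, w)\<close> from \<open>(s, w0 + w)\<close>.\<close>
    have "C *\<^sub>v x + Gy *\<^sub>v w = Gy *\<^sub>v w0 + C *\<^sub>v s + Gy *\<^sub>v w"
      using c by (simp add: vs distrib v')
    also have "\<dots> = C *\<^sub>v s + Gy *\<^sub>v (w0 + w)"
      unfolding distrib(5)[OF v'(2) w] using c v' w by (intro eq_vecI) auto
    finally have u: "feedback x w = feedback s (w0 + w)" by simp
    let ?u = "feedback s (w0 + w)"
    have uc: "?u \<in> carrier_vec m" using feedback_carrier[OF c(2) ww] .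
    have "A *\<^sub>v x + (B *\<^sub>v ?u + H *\<^sub>v w) = v' + H *\<^sub>v w0 + A *\<^sub>v s + (B *\<^sub>v ?u + H *\<^sub>v w)"
      using c by (simp add: vs distrib v')
    also have "\<dots> = v' + (A *\<^sub>v s + (B *\<^sub>v ?u + H *\<^sub>v (w0 + w)))"
      unfolding distrib(3)[OF v'(2) w] using c by (intro eq_vecI) auto
    finally have 1: "A *\<^sub>v x + (B *\<^sub>v ?u + H *\<^sub>v w) = v' + (A *\<^sub>v s + (B *\<^sub>v ?u + H *\<^sub>v (w0 + w)))" .
    have "v' \<in> SM"
      unfolding S_M_def using v'(1) subset_sum_left[OF is_subspaces(5,6)] by blast
    then have "A *\<^sub>v x + (B *\<^sub>v feedback x w + H *\<^sub>v w) \<in> SM + Vm"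
      unfolding u 1 using step[OF s ww] by (rule set_plus_intro)
    moreover have "E *\<^sub>v x + (Dz *\<^sub>v ?u + Gz *\<^sub>v w) = Gz *\<^sub>v w0 + E *\<^sub>v s + (Dz *\<^sub>v ?u + Gz *\<^sub>v w)"
      using c by (simp add: vs distrib v')
    then have "E *\<^sub>v x + (Dz *\<^sub>v ?u + Gz *\<^sub>v w) = E *\<^sub>v s + (Dz *\<^sub>v ?u + Gz *\<^sub>v (w0 + w))"
      unfolding distrib(8)[OF v'(2) w] using c by (auto intro!: eq_vecI)
    then have "E *\<^sub>v x + (Dz *\<^sub>v feedback x w + Gz *\<^sub>v w) = 0\<^sub>v r"
      unfolding u using maps s ww by (simp add: loop_maps_into_def)
    ultimately show "A *\<^sub>v x + (B *\<^sub>v feedback x w + H *\<^sub>v w) \<in> SM + Vm \<and>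
        E *\<^sub>v x + (Dz *\<^sub>v feedback x w + Gz *\<^sub>v w) = 0\<^sub>v r" ..
  qed
qed

text \<open>For \<open>x \<in> S_M\<close> and \<open>v \<in> V_bh\<close> let \<open>(u, w)\<close> be the inputs that \<open>v\<close> requires, and \<open>k\<close> the feedback of the
loop at \<open>(x, w)\<close>. Driving the loop at \<open>x\<close> with exactly this \<open>w\<close> supplies the term \<open>H w\<close> needed for
\<open>v\<close>, at the price of \<open>B k\<close>; the control input \<open>u - k\<close> thus does for \<open>x + v\<close>.\<close>

lemma output_nulling_SM_plus_V_bh:
  assumes maps: "loop_maps_into SM (SM + Vm)"
  shows "output_nulling A B E Dz (SM + V_bh)"
  unfolding output_nulling_iff[OF A B E Dz]
proof (intro conjI ballI)
  show "is_subspace n (SM + V_bh)"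
    using is_subspace_sum[OF is_subspace_SM is_subspaces(3)] .
  fix z assume "z \<in> SM + V_bh"
  then obtain x v where z: "x \<in> SM" "v \<in> V_bh" "z = x + v" by (auto simp: set_plus_def)
  obtain v' u w where v': "v' \<in> V_bh" "u \<in> carrier_vec m" "w \<in> carrier_vec q"
      "A *\<^sub>v v = v' + (B *\<^sub>v u + H *\<^sub>v w)" "E *\<^sub>v v = Dz *\<^sub>v u + Gz *\<^sub>v w"
    using Vstar_greatest(1)[OF A appended(1) E appended(2)] z(2)
    unfolding output_nulling_bh_iff by blast
  have c: "x \<in> carrier_vec n" "v \<in> carrier_vec n" "v' \<in> carrier_vec n"
    using z v' is_subspace_SM is_subspaces(3) by (auto simp: is_subspace_iff)
  let ?k = "feedback x w"
  have k: "?k \<in> carrier_vec m" using feedback_carrier[OF c(1) v'(3)] .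
  obtain y t where y: "y \<in> SM" "t \<in> Vm" "A *\<^sub>v x + (B *\<^sub>v ?k + H *\<^sub>v w) = y + t"
    using maps z v' unfolding loop_maps_into_def set_plus_def by blast
  have 0: "E *\<^sub>v x + (Dz *\<^sub>v ?k + Gz *\<^sub>v w) = 0\<^sub>v r"
    using maps z v' by (simp add: loop_maps_into_def)
  have c': "y \<in> carrier_vec n" "t \<in> carrier_vec n"
    using y is_subspace_SM is_subspace_Vm by (auto simp: is_subspace_iff)
  have "t + v' \<in> V_bh" using y(2) v'(1) is_subspaces(3) by (auto simp: V_m_def is_subspace_iff)
  then have mem: "y + (t + v') \<in> SM + V_bh" using y(1) by (intro set_plus_intro)
  have "A *\<^sub>v z = (A *\<^sub>v x + (B *\<^sub>v ?k + H *\<^sub>v w)) + v' + (B *\<^sub>v u - B *\<^sub>v ?k)"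
    unfolding z distrib(1)[OF c(1,2)] v' using c by (intro eq_vecI) auto
  also have "\<dots> = (y + (t + v')) + B *\<^sub>v (u - ?k)"
    unfolding y mult_minus_distrib_mat_vec[OF B v'(2) k] using c c' by (intro eq_vecI) auto
  finally have 1: "A *\<^sub>v z = (y + (t + v')) + B *\<^sub>v (u - ?k)" .
  have "E *\<^sub>v z = (E *\<^sub>v x + (Dz *\<^sub>v ?k + Gz *\<^sub>v w)) + (Dz *\<^sub>v u - Dz *\<^sub>v ?k)"
    unfolding z distrib(6)[OF c(1,2)] v' using c by (intro eq_vecI) auto
  also have "\<dots> = Dz *\<^sub>v (u - ?k)"
    unfolding 0 mult_minus_distrib_mat_vec[OF Dz v'(2) k] by (intro eq_vecI) auto
  finally show "\<exists>z'\<in>SM + V_bh. \<exists>u\<in>carrier_vec m.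
      A *\<^sub>v z = z' + B *\<^sub>v u \<and> E *\<^sub>v z = Dz *\<^sub>v u"
    using mem 1 v'(2) k by (intro bexI[of _ "y + (t + v')"] bexI[of _ "u - ?k"]) auto
qed

lemma loop_maps_into_Vstar_if_loop_maps_into_SM:
  assumes maps: "loop_maps_into SM (SM + Vm)"
  shows "loop_maps_into (Sstar A H C Gy) (Vstar A B E Dz)"
proof -
  have "Sstar A H C Gy \<subseteq> SM"
    using Sstar_subset_S_ce_if_loop_maps_into[OF maps S_ce_subset_SM] S_ce_subset_SM by blast
  moreover have "SM + Vm \<subseteq> SM + V_bh" by (auto simp: V_m_def set_plus_def)
  then have "SM + Vm \<subseteq> Vstar A B E Dz"
    using Vstar_greatest(2)[OF A B E Dz output_nulling_SM_plus_V_bh[OF maps]] by blast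
  ultimately show ?thesis
    using maps unfolding loop_maps_into_def by blast
qed

lemma static_loop_inclusions_iff:
  "(\<lambda>v. static_loop A B H C Gy E Dz Gz K *\<^sub>v v) ` (Sstar A H C Gy \<oplus>\<^sub>v carrier_vec q)
      \<subseteq> Vstar A B E Dz \<oplus>\<^sub>v {0\<^sub>v r} \<longleftrightarrow>
   (\<lambda>v. static_loop A B H C Gy E Dz Gz K *\<^sub>v v) ` (SM \<oplus>\<^sub>v carrier_vec q)
      \<subseteq> (SM + Vm) \<oplus>\<^sub>v {0\<^sub>v r}"
proof -
  have "Vstar A B E Dz \<subseteq> carrier_vec n" "Sstar A H C Gy \<subseteq> carrier_vec n"
    "SM \<subseteq> carrier_vec n" "SM + Vm \<subseteq> carrier_vec n"
    using is_subspaces(1,2) is_subspace_SM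
      is_subspace_sum[OF is_subspace_SM is_subspace_Vm] by (simp_all add: is_subspace_iff)
  then show ?thesis
    using loop_maps_into_SM_if_loop_maps_into_Vstar loop_maps_into_Vstar_if_loop_maps_into_SM
    by (simp add: static_loop_image_subset_iff[OF K] loop_maps_into_def[symmetric]) blast
qed

end

end

theorem theorem4:
  fixes n m q p r :: nat
    and A B H C Dy Gy E Dz Gz :: "real mat"
  assumes "A \<in> carrier_mat n n" and "B \<in> carrier_mat n m" and "H \<in> carrier_mat n q"
    and "C \<in> carrier_mat p n" and "Dy \<in> carrier_mat p m" and "Gy \<in> carrier_mat p q"
    and "E \<in> carrier_mat r n" and "Dz \<in> carrier_mat r m" and "Gz \<in> carrier_mat r q"
    and "ddp_solvable A B H C Dy Gy E Dz Gz"
  shows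
    "{K \<in> carrier_mat m p.
        (\<lambda>v. static_loop A B H C Gy E Dz Gz K *\<^sub>v v) ` (Sstar A H C Gy \<oplus>\<^sub>v carrier_vec q)
          \<subseteq> Vstar A B E Dz \<oplus>\<^sub>v {0\<^sub>v r}} =
     {K \<in> carrier_mat m p.
        (\<lambda>v. static_loop A B H C Gy E Dz Gz K *\<^sub>v v) ` (S_M A H C Gy E Gz \<oplus>\<^sub>v carrier_vec q)
          \<subseteq> (S_M A H C Gy E Gz + V_m A B H E Dz Gz) \<oplus>\<^sub>v {0\<^sub>v r}}"
proof -
  interpret plant n m q p r A B H C Gy E Dz Gz
    using assms by unfold_locales
  show ?thesis using static_loop_inclusions_iff by blast
qed

end
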